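(* Let $x=P(x)$ be a strongly connected PPS in simple normal form with rational coefficients, such that $P(\mathbf{1}) = \mathbf{1}$ and its LFP $q^*$ satisfies $\mathbf{0} < q^* < \mathbf{1}$. Then $q^*_i < 1 - 2^{-3|P|}$ for some $i \in\{1,\dots,n\}$.
   Context: A PPS is a system $x_i = P_i(x)$, $i=1,\dots,n$, with each $P_i$ a polynomial with nonnegative rational coefficients (including constant term) summing to at most $1$; its LFP $q^*$ is the coordinatewise least nonnegative solution. Simple normal form: each $P_i$ is either $x_jx_k$ or linear $\sum_j p_{i,j}x_j+p_{i,0}$. Strongly connected: the dependency graph (edge $x_i\to x_j$ iff $x_j$ occurs with positive coefficient in $P_i$) is strongly connected. $|P|$ is $n$ plus the total number of bits of all nonzero coefficients (binary numerator/denominator) and nonzero exponents. *)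

theory Defs
  imports Complex_Main "HOL-Library.Cardinality" "HOL-Library.Poly_Mapping" "HOL-Library.Log_Nat"
begin

text \<open>
  Multivariate polynomials with rational coefficients in variables indexed by \<open>'n\<close>: a finitely
  supported map from monomials to coefficients, a monomial being a finitely supported map from
  variables to exponents. Ring multiplication is the convolution product of
  \<^theory>\<open>HOL-Library.Poly_Mapping\<close>. The keys are exactly the monomials with nonzero coefficient
  (resp. the variables with nonzero exponent).
\<close>
type_synonym 'n rpoly = "('n \<Rightarrow>\<^sub>0 nat) \<Rightarrow>\<^sub>0 rat"

definition rpoly_const :: "rat \<Rightarrow> 'n rpoly" where
  "rpoly_const c = Poly_Mapping.single 0 c"

definition rpoly_var :: "'n \<Rightarrow> 'n rpoly" where
  "rpoly_var j = Poly_Mapping.single (Poly_Mapping.single j 1) 1"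

definition rpoly_eval :: "'n rpoly \<Rightarrow> ('n \<Rightarrow> real) \<Rightarrow> real" where
  "rpoly_eval p x =
     (\<Sum>m\<in>Poly_Mapping.keys p. of_rat (Poly_Mapping.lookup p m) *
        (\<Prod>j\<in>Poly_Mapping.keys m. x j ^ Poly_Mapping.lookup m j))"

text \<open>
  A system \<open>x\<^sub>i = P\<^sub>i(x)\<close> is represented by the family \<open>P\<close> of its right-hand sides; the index
  set is a finite type \<open>'n\<close>, so the number of variables is \<open>CARD('n) \<ge> 1\<close>.
\<close>
definition PPS :: "('n::finite \<Rightarrow> 'n rpoly) \<Rightarrow> bool" where
  "PPS P \<longleftrightarrow>
     (\<forall>i. (\<forall>m. Poly_Mapping.lookup (P i) m \<ge> 0) \<and>
          (\<Sum>m\<in>Poly_Mapping.keys (P i). Poly_Mapping.lookup (P i) m) \<le> 1)"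

definition simple_normal_form :: "('n::finite \<Rightarrow> 'n rpoly) \<Rightarrow> bool" where
  "simple_normal_form P \<longleftrightarrow>
     (\<forall>i. (\<exists>j k. P i = rpoly_var j * rpoly_var k) \<or>
          (\<exists>p p0. P i = (\<Sum>j\<in>UNIV. rpoly_const (p j) * rpoly_var j) + rpoly_const p0))"

definition dependency_graph :: "('n::finite \<Rightarrow> 'n rpoly) \<Rightarrow> ('n \<times> 'n) set" where
  "dependency_graph P =
     {(i, j). \<exists>m. Poly_Mapping.lookup (P i) m > 0 \<and> Poly_Mapping.lookup m j > 0}"

definition strongly_connected :: "('n::finite \<Rightarrow> 'n rpoly) \<Rightarrow> bool" where
  "strongly_connected P \<longleftrightarrow> (\<forall>i j. (i, j) \<in> (dependency_graph P)\<^sup>*)"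

definition is_solution :: "('n::finite \<Rightarrow> 'n rpoly) \<Rightarrow> ('n \<Rightarrow> real) \<Rightarrow> bool" where
  "is_solution P x \<longleftrightarrow> (\<forall>i. x i = rpoly_eval (P i) x)"

definition is_LFP :: "('n::finite \<Rightarrow> 'n rpoly) \<Rightarrow> ('n \<Rightarrow> real) \<Rightarrow> bool" where
  "is_LFP P q \<longleftrightarrow>
     (\<forall>i. q i \<ge> 0) \<and> is_solution P q \<and>
     (\<forall>x. (\<forall>i. x i \<ge> 0) \<and> is_solution P x \<longrightarrow> (\<forall>i. q i \<le> x i))"

text \<open>
  \<^const>\<open>bitlen\<close> is the length of the binary representation of a positive integer.
  \<^const>\<open>quotient_of\<close> returns numerator and denominator in lowest terms, with positive
  denominator; the sizes below are only meant for positive coefficients, so no sign is encoded.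
\<close>
definition rat_bits :: "rat \<Rightarrow> nat" where
  "rat_bits c = nat (bitlen (fst (quotient_of c))) + nat (bitlen (snd (quotient_of c)))"

definition rpoly_bits :: "'n rpoly \<Rightarrow> nat" where
  "rpoly_bits p =
     (\<Sum>m\<in>Poly_Mapping.keys p. rat_bits (Poly_Mapping.lookup p m) +
        (\<Sum>j\<in>Poly_Mapping.keys m. nat (bitlen (int (Poly_Mapping.lookup m j)))))"

definition pps_size :: "('n::finite \<Rightarrow> 'n rpoly) \<Rightarrow> nat" where
  "pps_size P = CARD('n) + (\<Sum>i\<in>UNIV. rpoly_bits (P i))"

end

theory Submission 
  imports Defs "HOL-Analysis.Determinants"
begin

text \<open>
  Let \<open>v = 1 - q\<close> have maximum \<open>\<epsilon>\<close> and let \<open>A\<close> be the Jacobian of \<open>P\<close> at \<open>1\<close>. Expanding at \<open>1\<close> gives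
  \<open>0 \<le> A v - v \<le> \<epsilon>\<^sup>2\<close>, and \<open>A v \<noteq> v\<close> because a linear system with a positive solution below \<open>1\<close> has
  smaller solutions. Let \<open>D\<close> be the product over all rows of four times the common denominator.
  Some row vector \<open>w \<ge> 0\<close> with entries at most \<open>D\<close> satisfies \<open>w A \<ge> w\<close> with an excess of at least
  \<open>1 / D\<close> in some coordinate \<open>k\<close>, whence \<open>v\<^sub>k / D \<le> w (A v - v) \<le> n D \<epsilon>\<^sup>2\<close>. Following a simple path to
  the coordinate that attains the maximum bounds \<open>\<epsilon>\<close> by \<open>v\<^sub>k\<close> times the product of the denominators.
  Together \<open>1 < D\<^sup>3 \<epsilon>\<close>, and \<open>D \<le> 2 ^ |P|\<close>.

  To find \<open>w\<close> without spectral theory, take a maximal index set \<open>T\<close> on which \<open>1 - A\<close> is a nonsingular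
  M-matrix. It is not everything, since \<open>A v \<ge> v\<close>. For \<open>u \<notin> T\<close> let \<open>w\<close> be supported on \<open>T \<union> {u}\<close>,
  with \<open>w\<^sub>u = 1\<close> and \<open>w A = w\<close> on \<open>T\<close>; maximality of \<open>T\<close> forces \<open>w A \<ge> w\<close> at \<open>u\<close>, irreducibility
  excludes \<open>w A = w\<close>, and Cramer's rule bounds the entries and the excess.
\<close>

section \<open>Size and integrality of determinants\<close>

text \<open>Expanding the product of the row sums gives one nonnegative term for each function from
  rows to columns; the Leibniz formula involves only those that are permutations.\<close>

lemma abs_det_le_prod_row_sums:
  fixes A :: "real^'n^'n"
  shows "\<bar>det A\<bar> \<le> (\<Prod>i\<in>UNIV. \<Sum>j\<in>UNIV. \<bar>A$i$j\<bar>)"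
proof -
  have "\<bar>det A\<bar> \<le> (\<Sum>p | p permutes (UNIV::'n set). \<Prod>i\<in>UNIV. \<bar>A$i$p i\<bar>)"
    unfolding det_def
    by (rule order_trans[OF sum_abs], rule sum_mono) (simp add: abs_mult sign_def abs_prod)
  also have "\<dots> \<le> (\<Sum>f\<in>UNIV \<rightarrow>\<^sub>E UNIV. \<Prod>i\<in>UNIV. \<bar>A$i$f i\<bar>)"
    by (rule sum_mono2) (auto intro: finite_PiE prod_nonneg)
  also have "\<dots> = (\<Prod>i\<in>UNIV. \<Sum>j\<in>UNIV. \<bar>A$i$j\<bar>)"
    by (rule prod_sum_PiE[symmetric]) auto
  finally show ?thesis .
qed

lemma det_in_Ints:
  fixes A :: "'a::comm_ring_1^'n^'n"
  assumes "\<And>i j. A$i$j \<in> \<int>"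
  shows "det A \<in> \<int>"
  unfolding det_def by (intro Ints_sum Ints_mult Ints_prod Ints_of_int assms)

section \<open>M-matrices and the left vector \<open>w\<close>\<close>

text \<open>
  A witness that \<open>1 - A\<close> restricted to \<open>T\<close> is a nonsingular M-matrix.
\<close>
definition left_contracted :: "('n::finite \<Rightarrow> 'n \<Rightarrow> real) \<Rightarrow> 'n set \<Rightarrow> ('n \<Rightarrow> real) \<Rightarrow> bool" where
  "left_contracted A T z \<longleftrightarrow>
     (\<forall>t\<in>T. 0 < z t \<and> (\<Sum>i\<in>UNIV. z i * A i t) < z t) \<and> (\<forall>t. t \<notin> T \<longrightarrow> z t = 0)"

text \<open>A minimum principle. If the least ratio \<open>m = y s / z s\<close> over
  \<open>T\<close> were negative, then \<open>y\<close> would dominate \<open>m z\<close>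
  everywhere, so \<open>m (z A)\<close> at \<open>s\<close> would be at most
  \<open>y s = m * z s\<close>; dividing by \<open>m < 0\<close> contradicts the strict contraction
  of \<open>z\<close> at \<open>s\<close>.\<close>

lemma left_contracted_nonneg:
  fixes A :: "'n::finite \<Rightarrow> 'n \<Rightarrow> real"
  assumes z: "left_contracted A T z" and A: "\<And>i j. 0 \<le> A i j"
    and out: "\<And>t. t \<notin> T \<Longrightarrow> 0 \<le> y t"
    and super: "\<And>t. t \<in> T \<Longrightarrow> (\<Sum>i\<in>UNIV. y i * A i t) \<le> y t"
  shows "0 \<le> y t"
proof (rule ccontr)
  assume neg: "\<not> 0 \<le> y t"
  then have tT: "t \<in> T" using out by blast
  have zpos: "0 < z s" if "s \<in> T" for s using z that by (simp add: left_contracted_def)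
  obtain s where s: "s \<in> T" and smin: "\<And>i. i \<in> T \<Longrightarrow> y s / z s \<le> y i / z i"
    using ex_min_if_finite[of "(\<lambda>i. y i / z i) ` T"] tT by (fastforce simp: not_less)
  define m where "m = y s / z s"
  have m: "m < 0"
    using smin[OF tT] neg zpos[OF tT] unfolding m_def
    by (meson divide_neg_pos le_less_trans not_le)
  have ge: "m * z i \<le> y i" for i
  proof (cases "i \<in> T")
    case True
    then show ?thesis using smin[OF True] zpos[OF True] by (simp add: m_def pos_le_divide_eq)
  next
    case False
    then show ?thesis using z out by (simp add: left_contracted_def)
  qed
  have "m * (\<Sum>i\<in>UNIV. z i * A i s) \<le> (\<Sum>i\<in>UNIV. y i * A i s)"
    unfolding sum_distrib_left mult.assoc[symmetric]
    by (intro sum_mono mult_right_mono ge A)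
  also have "\<dots> \<le> y s" by (rule super[OF s])
  also have "\<dots> = m * z s" using zpos[OF s] by (simp add: m_def)
  finally show False using m z s by (auto simp: left_contracted_def mult_le_cancel_left)
qed

lemma bilinear_form_assoc:
  fixes A :: "'n::finite \<Rightarrow> 'n \<Rightarrow> real"
  shows "(\<Sum>j\<in>UNIV. (\<Sum>i\<in>UNIV. w i * A i j) * v j) = (\<Sum>i\<in>UNIV. w i * (\<Sum>j\<in>UNIV. A i j * v j))"
  by (simp add: sum_distrib_left sum_distrib_right mult.assoc) (rule sum.swap)

text \<open>Pairing \<open>A v - v\<close> with \<open>w\<close> isolates the coordinate
  \<open>k\<close>. The entries of \<open>w\<close> come from Cramer's rule for an integral matrix
  whose determinant lies between \<open>1\<close> and \<open>D\<close> in absolute value, so the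
  same \<open>D\<close> controls both the entries and the excess.\<close>

lemma exists_bounded_left_subinvariant:
  fixes A :: "'n::finite \<Rightarrow> 'n \<Rightarrow> real" and v :: "'n \<Rightarrow> real" and den :: "'n \<Rightarrow> nat"
  assumes A: "\<And>i j. 0 \<le> A i j"
    and irr: "\<And>i j. (i, j) \<in> {(i, j). 0 < A i j}\<^sup>*"
    and v: "\<And>i. 0 < v i" and Av: "\<And>i. v i \<le> (\<Sum>j\<in>UNIV. A i j * v j)"
    and strict: "v i0 < (\<Sum>j\<in>UNIV. A i0 j * v j)"
    and den: "\<And>i. 1 \<le> den i" and ints: "\<And>i j. real (den i) * A i j \<in> \<int>"
    and rows: "\<And>i. (\<Sum>j\<in>UNIV. A i j) \<le> 2"
  defines "D \<equiv> (\<Prod>i\<in>UNIV. 4 * real (den i))"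
  obtains w k where "\<And>i. 0 \<le> w i" "\<And>i. w i \<le> D"
    "\<And>j. w j \<le> (\<Sum>i\<in>UNIV. w i * A i j)"
    "1 / D \<le> (\<Sum>i\<in>UNIV. w i * A i k) - w k"
proof -
  define good where "good T \<longleftrightarrow> (\<exists>z. left_contracted A T z)" for T
  have "good {}" by (auto simp: good_def left_contracted_def)
  then obtain T where T: "good T" and max: "\<And>S. good S \<Longrightarrow> T \<subseteq> S \<Longrightarrow> S = T"
    using finite_has_maximal[of "Collect good"] by auto
  from T obtain z where z: "left_contracted A T z" by (auto simp: good_def)
  \<comment> \<open>A contraction on all indices would make \<open>z A v\<close> smaller than
    \<open>z v\<close>, whereas \<open>A v \<ge> v\<close> makes it at least as large.\<close>
  have "T \<noteq> UNIV"
  proof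
    assume "T = UNIV"
    then have zA: "0 < z i" "(\<Sum>j\<in>UNIV. z j * A j i) < z i" for i
      using z by (auto simp: left_contracted_def)
    have "(\<Sum>j\<in>UNIV. (\<Sum>i\<in>UNIV. z i * A i j) * v j) < (\<Sum>j\<in>UNIV. z j * v j)"
      by (intro sum_strict_mono mult_strict_right_mono zA v) auto
    moreover have "(\<Sum>j\<in>UNIV. z j * v j) \<le> (\<Sum>i\<in>UNIV. z i * (\<Sum>j\<in>UNIV. A i j * v j))"
      by (intro sum_mono mult_left_mono Av less_imp_le zA)
    ultimately show False by (simp add: bilinear_form_assoc[of z A v])
  qed
  then obtain u where u: "u \<notin> T" by blast
  \<comment> \<open>The columns of \<open>1 - A\<close> in \<open>T\<close> and unit columns elsewhere; \<open>B\<close> is the transpose, scaled to be integral.\<close>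
  define N where "N i j = (if i = j then 1 else 0) - (if j \<in> T then A i j else 0)" for i j
  define B :: "real^'n^'n" where "B = (\<chi> j i. real (den i) * N i j)"
  have N_sum: "(\<Sum>i\<in>UNIV. w i * N i j) = w j - (if j \<in> T then \<Sum>i\<in>UNIV. w i * A i j else 0)"
    for w j
    by (simp add: N_def right_diff_distrib sum_subtractf if_distrib[of "\<lambda>x. _ * x"] cong: if_cong)
  have B_mult: "(B *v x) $ j = (\<Sum>i\<in>UNIV. (real (den i) * x $ i) * N i j)" for x j
    by (simp add: B_def matrix_vector_mult_def mult_ac)
  \<comment> \<open>The minimum principle applies to a kernel vector, rescaled by
    \<open>den\<close>, and to its negative.\<close>
  have "x = 0" if "B *v x = 0" for x
  proof -
    define y where "y i = real (den i) * x $ i" for i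
    have eq: "y j - (if j \<in> T then \<Sum>i\<in>UNIV. y i * A i j else 0) = 0" for j
      using B_mult[of x j] that by (simp add: y_def[symmetric] N_sum)
    have "0 \<le> y t" for t
      by (rule left_contracted_nonneg[OF z A]) (use eq in \<open>auto split: if_splits simp: algebra_simps\<close>)
    moreover have "0 \<le> - y t" for t
      by (rule left_contracted_nonneg[OF z A, of "\<lambda>t. - y t"])
         (use eq in \<open>auto split: if_splits simp: algebra_simps sum_negf\<close>)
    ultimately have "y t = 0" for t by (metis neg_0_le_iff_le order_antisym)
    moreover have "den t \<noteq> 0" for t using den[of t] by simp
    ultimately show ?thesis by (auto simp: y_def vec_eq_iff)
  qed
  then have "det B \<noteq> 0"
    using matrix_left_invertible_ker[of B] invertible_det_nz[of B] invertible_left_inverse[of B] by blast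
  have N_ints: "real (den i) * N i j \<in> \<int>" for i j
    using ints[of i j] by (auto simp: N_def algebra_simps)
  \<comment> \<open>The unit entry and the row sum of \<open>A\<close> give at most
    \<open>3\<close>; rounding up to \<open>4\<close> makes the constant a power of two, as the bit
    count requires.\<close>
  have N_rows: "(\<Sum>j\<in>UNIV. \<bar>real (den i) * N i j\<bar>) \<le> 4 * real (den i)" for i
  proof -
    have "(\<Sum>j\<in>UNIV. \<bar>N i j\<bar>) \<le> (\<Sum>j\<in>UNIV. (if i = j then 1 else 0) + A i j)"
      by (rule sum_mono) (use A in \<open>auto simp: N_def abs_le_iff intro: add_nonneg_nonneg\<close>)
    also have "\<dots> \<le> 4" using rows[of i] by (simp add: sum.distrib)
    finally show ?thesis by (simp add: abs_mult sum_distrib_left[symmetric] mult.commute[of 4] mult_left_mono)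
  qed
  have B_ints: "B $ i $ j \<in> \<int>" for i j using N_ints by (simp add: B_def)
  have "\<bar>det B\<bar> \<le> D"
  proof -
    have "\<bar>det B\<bar> = \<bar>det (transpose B)\<bar>" by simp
    also have "\<dots> \<le> D"
      unfolding D_def
      by (rule order_trans[OF abs_det_le_prod_row_sums], rule prod_mono)
         (use N_rows in \<open>auto simp: B_def transpose_def intro: sum_nonneg\<close>)
    finally show ?thesis .
  qed
  have det1: "1 \<le> \<bar>det B\<bar>"
    using det_in_Ints[OF B_ints] \<open>det B \<noteq> 0\<close> by (auto simp: Ints_nonzero_abs_ge1)
  \<comment> \<open>Cramer's rule for the right-hand side \<open>axis u 1\<close>. After undoing the
    scaling by \<open>den\<close>, its solution \<open>w\<close> satisfies \<open>w A = w\<close> on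
    \<open>T\<close>, equals \<open>1\<close> at \<open>u\<close> and vanishes elsewhere.\<close>
  define C where "C k = (\<chi> i j. if j = k then axis u 1 $ i else B $ i $ j)" for k
  define x where "x = (\<chi> k. det (C k) / det B)"
  have Bx: "B *v x = axis u 1"
    using cramer[OF \<open>det B \<noteq> 0\<close>, of x "axis u 1"] by (simp add: x_def C_def)
  define w where "w i = real (den i) * x $ i" for i
  have w_eq: "w j - (if j \<in> T then \<Sum>i\<in>UNIV. w i * A i j else 0) = (if j = u then 1 else 0)" for j
    using B_mult[of x j] unfolding Bx w_def[symmetric] N_sum by (simp add: axis_def split: if_splits)
  have w_T: "(\<Sum>i\<in>UNIV. w i * A i j) = w j" if "j \<in> T" for j
    using w_eq[of j] that u by (auto split: if_splits)
  have w_u: "w u = 1" using w_eq[of u] u by simp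
  have w_out: "w j = 0" if "j \<notin> T" "j \<noteq> u" for j using w_eq[of j] that by simp
  have w_nonneg: "0 \<le> w i" for i
  proof (rule left_contracted_nonneg[OF z A])
    fix t show "0 \<le> w t" if "t \<notin> T" using that w_u w_out[of t] by (cases "t = u") auto
  qed (simp add: w_T)
  \<comment> \<open>Column \<open>k\<close> of \<open>C k\<close> has absolute sum \<open>1\<close>,
    so the factor for \<open>k\<close> is absent from the determinant bound; it leaves room for the
    \<open>den k\<close> in \<open>w k\<close>.\<close>
  have w_le: "w k \<le> D" for k
  proof -
    have "\<bar>det (C k)\<bar> = \<bar>det (transpose (C k))\<bar>" by simp
    also have "\<dots> \<le> (\<Prod>i\<in>UNIV. if i = k then 1 else 4 * real (den i))"
    proof (rule order_trans[OF abs_det_le_prod_row_sums], rule prod_mono, safe)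
      fix i
      show "(\<Sum>j\<in>UNIV. \<bar>transpose (C k) $ i $ j\<bar>) \<le> (if i = k then 1 else 4 * real (den i))"
        using N_rows[of i]
        by (auto simp: C_def B_def transpose_def axis_def if_distrib[of abs] cong: if_cong)
    qed
    also have "\<dots> = (\<Prod>i\<in>UNIV-{k}. 4 * real (den i))"
      by (subst prod.remove[of _ k]) (auto intro: prod.cong)
    finally have C: "\<bar>det (C k)\<bar> \<le> (\<Prod>i\<in>UNIV-{k}. 4 * real (den i))" .
    have "\<bar>x $ k\<bar> \<le> \<bar>det (C k)\<bar>"
      using divide_left_mono[OF det1, of "\<bar>det (C k)\<bar>"] \<open>det B \<noteq> 0\<close> by (simp add: x_def)
    then have "\<bar>x $ k\<bar> \<le> (\<Prod>i\<in>UNIV-{k}. 4 * real (den i))" using C by linarith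
    then have "real (den k) * \<bar>x $ k\<bar> \<le> (4 * real (den k)) * (\<Prod>i\<in>UNIV-{k}. 4 * real (den i))"
      by (intro mult_mono) auto
    also have "\<dots> = D" unfolding D_def by (subst prod.remove[of UNIV k]) auto
    finally show ?thesis unfolding w_def by (smt (verit) abs_ge_self mult_left_mono of_nat_0_le_iff)
  qed
  have sub_u: "w u \<le> (\<Sum>i\<in>UNIV. w i * A i u)"
  proof (rule ccontr)
    assume gap: "\<not> ?thesis"
    define s where "s = (\<Sum>i\<in>UNIV. z i * A i u)"
    define c where "c = w u - (\<Sum>i\<in>UNIV. w i * A i u)"
    \<comment> \<open>Adding \<open>h z\<close> makes the inequalities on \<open>T\<close> strict.
      The choice of \<open>h\<close> gives \<open>h * s \<le> c / 2 < c\<close>, so strictness at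
      \<open>u\<close> survives, and \<open>1 + \<bar>s\<bar>\<close> keeps the divisor positive.
      The sum then contracts on \<open>insert u T\<close>.\<close>
    define h where "h = c / 2 / (1 + \<bar>s\<bar>)"
    have c: "0 < c" using gap by (simp add: c_def)
    then have h: "0 < h" by (simp add: h_def)
    have "h * s \<le> h * (1 + \<bar>s\<bar>)" using h by (intro mult_left_mono) auto
    also have "\<dots> = c / 2"
      using h_def abs_ge_zero[of s] by (metis add_pos_nonneg less_irrefl nonzero_eq_divide_eq zero_less_one)
    also have "\<dots> < c" using c by linarith
    finally have "h * s < w u - (\<Sum>i\<in>UNIV. w i * A i u)" by (simp add: c_def)
    moreover have "(\<Sum>i\<in>UNIV. (w i + h * z i) * A i t)
        = (\<Sum>i\<in>UNIV. w i * A i t) + h * (\<Sum>i\<in>UNIV. z i * A i t)" for t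
      by (simp add: distrib_right sum.distrib sum_distrib_left mult.assoc)
    moreover have "z u = 0" using z u by (simp add: left_contracted_def)
    ultimately have "left_contracted A (insert u T) (\<lambda>i. w i + h * z i)"
      using z h w_nonneg w_T w_u w_out
      by (auto simp: left_contracted_def s_def add_nonneg_pos)
    then have "insert u T = T" by (intro max) (auto simp: good_def)
    then show False using u by blast
  qed
  have w_sub: "w j \<le> (\<Sum>i\<in>UNIV. w i * A i j)" for j
  proof -
    have "0 \<le> (\<Sum>i\<in>UNIV. w i * A i j)" by (intro sum_nonneg mult_nonneg_nonneg w_nonneg A)
    then show ?thesis using w_T[of j] w_out[of j] sub_u by (cases "j \<in> T"; cases "j = u") auto
  qed
  \<comment> \<open>If \<open>w A = w\<close>, positivity spreads from \<open>u\<close> along the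
    edges to every index, and pairing with \<open>v\<close> contradicts the strict inequality at
    \<open>i0\<close>.\<close>
  have "\<exists>k. w k < (\<Sum>i\<in>UNIV. w i * A i k)"
  proof (rule ccontr)
    assume "\<not> ?thesis"
    then have inv: "(\<Sum>i\<in>UNIV. w i * A i k) = w k" for k using w_sub[of k] by (meson not_less order_antisym)
    have "0 < w i" for i
      using irr[of u i]
    proof induction
      case base show ?case by (simp add: w_u)
    next
      case (step i j)
      then have "0 < w i * A i j" by simp
      also have "\<dots> \<le> (\<Sum>i\<in>UNIV. w i * A i j)"
        by (rule member_le_sum) (auto intro: mult_nonneg_nonneg w_nonneg A)
      finally show ?case by (simp add: inv)
    qed
    then have "(\<Sum>i\<in>UNIV. w i * v i) < (\<Sum>i\<in>UNIV. w i * (\<Sum>j\<in>UNIV. A i j * v j))"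
      using strict by (intro sum_strict_mono_ex1) (auto intro: mult_left_mono Av w_nonneg)
    then show False using bilinear_form_assoc[of w A v] by (simp add: inv)
  qed
  then obtain k where k: "w k < (\<Sum>i\<in>UNIV. w i * A i k)" by blast
  define g where "g = (\<Sum>i\<in>UNIV. w i * A i k) - w k"
  \<comment> \<open>The factor \<open>den i\<close> in \<open>w i * det B\<close> clears the
    denominators of row \<open>i\<close> of \<open>A\<close>. A nonzero integer has absolute value
    at least \<open>1\<close>, which bounds \<open>g\<close> from below.\<close>
  have "g * det B \<in> \<int>"
  proof -
    have C_ints: "det (C i) \<in> \<int>" for i
      by (rule det_in_Ints) (auto simp: C_def axis_def B_ints)
    have w_det: "w i * det B = real (den i) * det (C i)" for i
      using \<open>det B \<noteq> 0\<close> by (simp add: w_def x_def)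
    have "g = (\<Sum>i\<in>UNIV. w i * (A i k - (if i = k then 1 else 0)))"
      by (simp add: g_def right_diff_distrib sum_subtractf if_distrib[of "\<lambda>x. _ * x"] cong: if_cong)
    then have "g * det B = (\<Sum>i\<in>UNIV. (w i * det B) * (A i k - (if i = k then 1 else 0)))"
      by (simp only: sum_distrib_left mult_ac)
    also have "\<dots> = (\<Sum>i\<in>UNIV. det (C i) * (real (den i) * A i k - (if i = k then real (den i) else 0)))"
      unfolding w_det by (rule sum.cong) (auto simp: algebra_simps)
    also have "\<dots> \<in> \<int>" by (intro Ints_sum Ints_mult[OF C_ints] Ints_diff ints) auto
    finally show ?thesis .
  qed
  moreover have g: "0 < g" using k by (simp add: g_def)
  ultimately have "1 \<le> \<bar>g * det B\<bar>"
    using \<open>det B \<noteq> 0\<close> by (intro Ints_nonzero_abs_ge1) auto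
  also have "\<dots> \<le> g * D" using g \<open>\<bar>det B\<bar> \<le> D\<close> by (simp add: abs_mult)
  finally have "1 / D \<le> g"
    using det1 \<open>\<bar>det B\<bar> \<le> D\<close> by (simp add: divide_le_eq)
  then show thesis using that[of w k] w_nonneg w_le w_sub by (simp add: g_def)
qed

section \<open>Comparing coordinates and bounding the maximum\<close>

text \<open>Growing a set of indices, instead of following a walk, charges each denominator only
  once. An edge from outside into a maximal good set would allow its source to be added, so such a
  set contains every index with a path to \<open>m\<close>.\<close>

lemma strongly_connected_ratio_bound:
  fixes v :: "'n::finite \<Rightarrow> real" and den :: "'n \<Rightarrow> nat"
  assumes conn: "\<And>i j. (i, j) \<in> E\<^sup>*"
    and v: "\<And>i. 0 < v i" and den: "\<And>i. 1 \<le> den i"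
    and edge: "\<And>i j. (i, j) \<in> E \<Longrightarrow> v j \<le> real (den i) * v i"
  shows "v m \<le> (\<Prod>k\<in>UNIV. real (den k)) * v i"
proof -
  define good where "good S \<longleftrightarrow> m \<in> S \<and> (\<forall>i\<in>S. v m \<le> (\<Prod>k\<in>S. real (den k)) * v i)" for S
  have "good {m}" using den[of m] v[of m] by (simp add: good_def mult_le_cancel_right1)
  then obtain S where S: "good S" and max: "\<And>R. good R \<Longrightarrow> S \<subseteq> R \<Longrightarrow> R = S"
    using finite_has_maximal[of "Collect good"] by auto
  have "i \<in> S" for i
  proof -
    have "m \<in> S" using S by (simp add: good_def)
    with conn[of i m] show ?thesis
    proof (induction rule: converse_rtrancl_induct)
      case (step i j)
      show ?case
      proof (rule ccontr)
        assume i: "i \<notin> S"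
        let ?p = "\<Prod>k\<in>S. real (den k)"
        have p: "0 \<le> ?p" by (intro prod_nonneg) auto
        have "v m \<le> ?p * v j" using S step by (auto simp: good_def)
        also have "\<dots> \<le> ?p * (den i * v i)" by (intro mult_left_mono edge step p)
        finally have "v m \<le> (den i * ?p) * v i" by (simp add: mult_ac)
        moreover have "v m \<le> (den i * ?p) * v l" if "l \<in> S" for l
        proof -
          have "v m \<le> 1 * (?p * v l)" using S that by (simp add: good_def)
          also have "\<dots> \<le> den i * (?p * v l)"
            using den[of i] p v[of l] by (intro mult_right_mono) (auto intro: mult_nonneg_nonneg less_imp_le)
          finally show ?thesis by (simp add: mult_ac)
        qed
        ultimately have "good (insert i S)" using i S by (auto simp: good_def)
        then show False using max[of "insert i S"] i by blast
      qed
    qed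
  qed
  then show ?thesis using S by (auto simp: good_def UNIV_eq_I[of S])
qed


lemma subinvariant_vector_max_bound:
  fixes A :: "'n::finite \<Rightarrow> 'n \<Rightarrow> real" and v :: "'n \<Rightarrow> real" and den :: "'n \<Rightarrow> nat"
  assumes A: "\<And>i j. 0 \<le> A i j"
    and irr: "\<And>i j. (i, j) \<in> {(i, j). 0 < A i j}\<^sup>*"
    and v: "\<And>i. 0 < v i" and v_le: "\<And>i. v i \<le> v m"
    and Av: "\<And>i. v i \<le> (\<Sum>j\<in>UNIV. A i j * v j)"
    and defect: "\<And>i. (\<Sum>j\<in>UNIV. A i j * v j) - v i \<le> (v m)\<^sup>2"
    and strict: "v i0 < (\<Sum>j\<in>UNIV. A i0 j * v j)"
    and den: "\<And>i. 1 \<le> den i" and ints: "\<And>i j. real (den i) * A i j \<in> \<int>"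
    and rows: "\<And>i. (\<Sum>j\<in>UNIV. A i j) \<le> 2"
    and edge: "\<And>i j. 0 < A i j \<Longrightarrow> v j \<le> real (den i) * v i"
  shows "1 < (\<Prod>i\<in>UNIV. 4 * real (den i)) ^ 3 * v m"
proof -
  define D where "D = (\<Prod>i\<in>UNIV. 4 * real (den i))"
  define d where "d = (\<Prod>i\<in>UNIV. real (den i))"
  define n where "n = real CARD('n)"
  have d: "1 \<le> d" unfolding d_def using den by (intro prod_ge_1) auto
  \<comment> \<open>The factors \<open>4\<close> in \<open>D\<close> absorb the dimension
    \<open>n\<close>. This bounds \<open>n * d\<close> by the third factor \<open>D\<close> and
    makes the final inequality strict.\<close>
  have "n < 4 ^ CARD('n)" unfolding n_def
    by (rule of_nat_less_numeral_power_cancel_iff[THEN iffD2]) (rule power_gt_expt, simp)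
  then have "n * d < 4 ^ CARD('n) * d" using d by (intro mult_strict_right_mono) auto
  also have "\<dots> = D" by (simp add: D_def d_def prod.distrib)
  finally have nd: "n * d < D" .
  have n: "0 < n" by (simp add: n_def)
  have D: "0 < D" using nd n d by (smt (verit) mult_pos_pos)
  obtain w k where w: "\<And>i. 0 \<le> w i" "\<And>i. w i \<le> D"
    and sub: "\<And>j. w j \<le> (\<Sum>i\<in>UNIV. w i * A i j)"
    and k: "1 / D \<le> (\<Sum>i\<in>UNIV. w i * A i k) - w k"
    using exists_bounded_left_subinvariant[where A=A and v=v and den=den, OF A irr v Av strict den ints rows]
    unfolding D_def by blast
  have "v k / D \<le> ((\<Sum>i\<in>UNIV. w i * A i k) - w k) * v k"
    using mult_right_mono[OF k, of "v k"] v[of k] by simp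
  \<comment> \<open>All other terms are nonnegative because \<open>w A \<ge> w\<close>; moving
    \<open>A\<close> to the other side turns the sum into \<open>w\<close> paired with the defect of
    \<open>v\<close>.\<close>
  also have "\<dots> \<le> (\<Sum>j\<in>UNIV. ((\<Sum>i\<in>UNIV. w i * A i j) - w j) * v j)"
    by (rule member_le_sum) (use sub v in \<open>auto intro!: mult_nonneg_nonneg simp: less_imp_le\<close>)
  also have "\<dots> = (\<Sum>i\<in>UNIV. w i * ((\<Sum>j\<in>UNIV. A i j * v j) - v i))"
    using bilinear_form_assoc[of w A v] by (simp add: left_diff_distrib right_diff_distrib sum_subtractf)
  also have "\<dots> \<le> (\<Sum>i\<in>(UNIV::'n set). D * (v m)\<^sup>2)"
    using w defect Av D by (intro sum_mono mult_mono) auto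
  finally have "v k \<le> n * (v m)\<^sup>2 * D\<^sup>2"
    using D by (simp add: n_def divide_le_eq power2_eq_square mult_ac)
  moreover have "v m \<le> d * v k"
    unfolding d_def using strongly_connected_ratio_bound[where v=v and den=den, OF irr v den] edge by blast
  ultimately have "v m \<le> d * (n * (v m)\<^sup>2 * D\<^sup>2)"
    using d by (smt (verit) mult_left_mono)
  then have "v m * 1 \<le> v m * ((n * d) * (D\<^sup>2 * v m))"
    by (simp add: power2_eq_square mult_ac)
  then have "1 \<le> (n * d) * (D\<^sup>2 * v m)" using v[of m] by (simp only: mult_le_cancel_left_pos)
  also have "\<dots> < D * (D\<^sup>2 * v m)" using nd D v[of m] by (intro mult_strict_right_mono) auto
  finally show ?thesis unfolding D_def[symmetric] by (simp add: power2_eq_square power3_eq_cube mult_ac)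
qed

section \<open>Evaluation, common denominators and bit sizes\<close>

lemma rpoly_eval_superset:
  assumes "finite M" "Poly_Mapping.keys p \<subseteq> M"
  shows "rpoly_eval p x = (\<Sum>m\<in>M. of_rat (Poly_Mapping.lookup p m) *
        (\<Prod>j\<in>Poly_Mapping.keys m. x j ^ Poly_Mapping.lookup m j))"
  unfolding rpoly_eval_def
  by (rule sum.mono_neutral_left) (use assms in \<open>auto simp: in_keys_iff\<close>)

text \<open>The product, rather than the least common multiple, can be compared with the bit sizes
  factor by factor.\<close>

definition rpoly_den :: "'n rpoly \<Rightarrow> nat" where
  "rpoly_den p = (\<Prod>m\<in>Poly_Mapping.keys p. nat (snd (quotient_of (Poly_Mapping.lookup p m))))"

lemma rpoly_den_ge_1: "1 \<le> rpoly_den p"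
  unfolding rpoly_den_def
  by (rule prod_ge_1) (simp add: Suc_le_eq quotient_of_denom_pos')

lemma rpoly_den_mult_lookup_Ints:
  "real (rpoly_den p) * of_rat (Poly_Mapping.lookup p m) \<in> \<int>"
proof (cases "m \<in> Poly_Mapping.keys p")
  case True
  let ?c = "Poly_Mapping.lookup p m"
  obtain a b where ab: "quotient_of ?c = (a, b)" by fastforce
  then have b: "0 < b" by (rule quotient_of_denom_pos)
  have "?c = of_int a / of_int b" by (rule quotient_of_div[OF ab])
  then have c: "of_rat ?c = (real_of_int a / real_of_int b)" by (simp add: of_rat_divide)
  obtain r where "rpoly_den p = nat b * r"
    using True ab unfolding rpoly_den_def by (subst (asm) prod.remove[of _ m]) auto
  then show ?thesis using b by (simp add: c)
qed (simp add: in_keys_iff)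

text \<open>The denominator bits bound each denominator, and the numerator of a positive coefficient
  has at least one bit, which pays for a factor \<open>2\<close>. One coefficient suffices for the
  claim.\<close>

lemma two_rpoly_den_le:
  assumes nonneg: "\<And>m. 0 \<le> Poly_Mapping.lookup p m" and ne: "Poly_Mapping.keys p \<noteq> {}"
  shows "2 * rpoly_den p \<le> 2 ^ rpoly_bits p"
proof -
  have fac: "2 * nat (snd (quotient_of c)) \<le> 2 ^ rat_bits c" if "0 < c" for c
  proof -
    obtain a b where ab: "quotient_of c = (a, b)" by fastforce
    then have b: "0 < b" by (rule quotient_of_denom_pos)
    have "c = of_int a / of_int b" by (rule quotient_of_div[OF ab])
    with that b have "0 < a" by (simp add: zero_less_divide_iff)
    then have "1 \<le> nat (bitlen a)" using bitlen_eq_zero_iff[of a] bitlen_nonneg[of a] by linarith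
    moreover have "nat b \<le> 2 ^ nat (bitlen b)" using bitlen_bounds[OF b] by (simp add: nat_le_iff)
    ultimately have "2 ^ 1 * nat b \<le> 2 ^ nat (bitlen a) * 2 ^ nat (bitlen b)"
      by (intro mult_mono power_increasing) auto
    then show ?thesis by (simp add: rat_bits_def ab power_add)
  qed
  let ?K = "Poly_Mapping.keys p"
  have "2 * rpoly_den p \<le> 2 ^ card ?K * rpoly_den p"
    using ne self_le_power[of "2::nat" "card ?K"] by (intro mult_right_mono) (auto simp: card_gt_0_iff)
  also have "\<dots> = (\<Prod>m\<in>?K. 2 * nat (snd (quotient_of (Poly_Mapping.lookup p m))))"
    by (simp add: rpoly_den_def prod.distrib)
  also have "\<dots> \<le> (\<Prod>m\<in>?K. 2 ^ rat_bits (Poly_Mapping.lookup p m))"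
    using nonneg by (intro prod_mono) (auto intro!: fac simp: in_keys_iff order_less_le)
  also have "\<dots> = 2 ^ (\<Sum>m\<in>?K. rat_bits (Poly_Mapping.lookup p m))" by (simp add: power_sum)
  also have "\<dots> \<le> 2 ^ rpoly_bits p"
    unfolding rpoly_bits_def by (intro power_increasing sum_mono) auto
  finally show ?thesis .
qed

section \<open>The two normal forms and their linearization at \<open>1\<close>\<close>

abbreviation rpoly_affine :: "('n::finite \<Rightarrow> rat) \<Rightarrow> rat \<Rightarrow> 'n rpoly" where
  "rpoly_affine c c0 \<equiv> (\<Sum>j\<in>UNIV. rpoly_const (c j) * rpoly_var j) + rpoly_const c0"

lemma rpoly_eval_product:
  "rpoly_eval (rpoly_var j * rpoly_var k) x = x j * x k"
proof -
  have "rpoly_var j * rpoly_var k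
      = Poly_Mapping.single (Poly_Mapping.single j 1 + Poly_Mapping.single k 1) 1"
    by (simp add: rpoly_var_def mult_single)
  then have "rpoly_eval (rpoly_var j * rpoly_var k) x =
      (\<Prod>l\<in>{j, k}. x l ^ Poly_Mapping.lookup (Poly_Mapping.single j 1 + Poly_Mapping.single k 1) l)"
    by (simp add: rpoly_eval_def)
       (rule prod.mono_neutral_left, auto simp: in_keys_iff lookup_add lookup_single when_def split: if_splits)
  then show ?thesis by (cases "j = k") (auto simp: lookup_add lookup_single power2_eq_square)
qed

lemma lookup_product_pos:
  assumes "0 < Poly_Mapping.lookup (rpoly_var j * rpoly_var k) m" "0 < Poly_Mapping.lookup m l"
  shows "l = j \<or> l = k"
  using assms
  by (auto simp: rpoly_var_def mult_single lookup_single lookup_add when_def split: if_splits)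

lemma lookup_affine:
  "Poly_Mapping.lookup (rpoly_affine c c0) m
     = (\<Sum>j\<in>UNIV. if Poly_Mapping.single j 1 = m then c j else 0) + (if m = 0 then c0 else 0)"
  by (auto simp: rpoly_var_def rpoly_const_def mult_single lookup_add lookup_sum lookup_single when_def)

lemma single_one_eq_iff: "Poly_Mapping.single j (1::nat) = Poly_Mapping.single k 1 \<longleftrightarrow> j = k"
  by (metis lookup_single_eq lookup_single_not_eq zero_neq_one)

lemma single_one_neq_0: "Poly_Mapping.single j (1::nat) \<noteq> 0"
  by (metis lookup_single_eq lookup_zero zero_neq_one)

lemma lookup_affine_var: "Poly_Mapping.lookup (rpoly_affine c c0) (Poly_Mapping.single j 1) = c j"
  unfolding lookup_affine single_one_eq_iff by (simp add: single_one_neq_0[simplified])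

lemma lookup_affine_const: "Poly_Mapping.lookup (rpoly_affine c c0) 0 = c0"
  unfolding lookup_affine by (simp add: single_one_neq_0[simplified])

lemma keys_affine:
  "Poly_Mapping.keys (rpoly_affine c c0) \<subseteq> insert 0 (range (\<lambda>j. Poly_Mapping.single j 1))"
proof
  fix m assume m: "m \<in> Poly_Mapping.keys (rpoly_affine c c0)"
  show "m \<in> insert 0 (range (\<lambda>j. Poly_Mapping.single j 1))"
  proof (rule ccontr)
    assume "\<not> ?thesis"
    then have "m \<noteq> 0" "\<And>j. Poly_Mapping.single j 1 \<noteq> m" by auto
    then have "Poly_Mapping.lookup (rpoly_affine c c0) m = 0" unfolding lookup_affine by simp
    with m show False by (simp add: in_keys_iff)
  qed
qed

lemma rpoly_eval_affine:
  "rpoly_eval (rpoly_affine c c0) x = (\<Sum>j\<in>UNIV. of_rat (c j) * x j) + of_rat c0"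
proof -
  have inj: "inj (\<lambda>j::'a. Poly_Mapping.single j (1::nat))"
    unfolding inj_def single_one_eq_iff by blast
  have "(0::'a \<Rightarrow>\<^sub>0 nat) \<notin> range (\<lambda>j. Poly_Mapping.single j 1)"
    using single_one_neq_0 by (metis imageE)
  then show ?thesis
    unfolding rpoly_eval_superset[OF _ keys_affine, simplified]
    using inj lookup_affine_var[of c c0] lookup_affine_const[of c c0]
    by (simp add: sum.reindex)
qed

text \<open>For an affine row the expansion at \<open>1\<close> is exact, so there is no quadratic
  defect.\<close>

lemma linearized_affine_row:
  fixes q :: "'n::finite \<Rightarrow> real"
  assumes p: "p = rpoly_affine c c0" and nonneg: "\<And>m. 0 \<le> Poly_Mapping.lookup p m"
    and one: "rpoly_eval p (\<lambda>_. 1) = 1" and q: "\<And>i. q i < 1"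
  defines "a \<equiv> \<lambda>j. real_of_rat (c j)"
  shows "0 \<le> a j" "real (rpoly_den p) * a j \<in> \<int>" "(\<Sum>j\<in>UNIV. a j) \<le> 2"
    "0 < Poly_Mapping.lookup p m \<Longrightarrow> 0 < Poly_Mapping.lookup m j \<Longrightarrow> 0 < a j"
    "0 < a j \<Longrightarrow> 1 - q j \<le> real (rpoly_den p) * (1 - rpoly_eval p q)"
    "(\<Sum>j\<in>UNIV. a j * (1 - q j)) = 1 - rpoly_eval p q"
proof -
  have a: "0 \<le> a j" "real (rpoly_den p) * a j \<in> \<int>" for j
    using nonneg[of "Poly_Mapping.single j 1"] rpoly_den_mult_lookup_Ints[of p "Poly_Mapping.single j 1"]
    unfolding p lookup_affine_var a_def by auto
  then show "0 \<le> a j" "real (rpoly_den p) * a j \<in> \<int>" by auto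
  have "0 \<le> real_of_rat c0" using nonneg[of 0] unfolding p lookup_affine_const by simp
  moreover have a1: "(\<Sum>j\<in>UNIV. a j) + of_rat c0 = 1"
    using one unfolding p rpoly_eval_affine a_def by simp
  ultimately show "(\<Sum>j\<in>UNIV. a j) \<le> 2" by linarith
  show "0 < a j" if m: "0 < Poly_Mapping.lookup p m" "0 < Poly_Mapping.lookup m j"
  proof -
    have "m \<in> Poly_Mapping.keys p" using m by (simp add: in_keys_iff)
    then have "m = Poly_Mapping.single j 1"
      using keys_affine[of c c0] m(2) unfolding p by (fastforce simp: lookup_single when_def split: if_splits)
    then show ?thesis using m(1) lookup_affine_var[of c c0 j] by (simp add: a_def p)
  qed
  show sum: "(\<Sum>j\<in>UNIV. a j * (1 - q j)) = 1 - rpoly_eval p q"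
    using a1 unfolding p rpoly_eval_affine
    by (simp add: a_def right_diff_distrib sum_subtractf)
  show "1 - q j \<le> real (rpoly_den p) * (1 - rpoly_eval p q)" if "0 < a j"
  proof -
    \<comment> \<open>A positive integer is at least \<open>1\<close>, hence a positive coefficient
      is at least the reciprocal of the common denominator.\<close>
    have "0 < real (rpoly_den p) * a j" using that rpoly_den_ge_1[of p] by simp
    then have "1 \<le> real (rpoly_den p) * a j"
      by (metis Ints_nonzero_abs_ge1 a(2) abs_of_pos less_irrefl)
    then have "1 - q j \<le> (real (rpoly_den p) * a j) * (1 - q j)"
      using q[of j] by (simp add: mult_le_cancel_right1)
    also have "\<dots> = real (rpoly_den p) * (a j * (1 - q j))" by simp
    also have "\<dots> \<le> real (rpoly_den p) * (\<Sum>j\<in>UNIV. a j * (1 - q j))"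
      using a(1) q by (intro mult_left_mono member_le_sum) (auto intro!: mult_nonneg_nonneg simp: less_imp_le)
    finally show ?thesis by (simp add: sum)
  qed
qed

text \<open>Here \<open>a\<close> is the gradient of the product at \<open>1\<close>, with entry
  \<open>2\<close> if \<open>k = l\<close>. The term \<open>(1 - q k) * (1 - q l)\<close> is the
  second-order remainder, the source of the quadratic defect and of its positivity.\<close>

lemma linearized_product_row:
  fixes q :: "'n::finite \<Rightarrow> real"
  assumes p: "p = rpoly_var k * rpoly_var l" and q: "\<And>i. 0 < q i" "\<And>i. q i < 1"
    and a_def: "a = (\<lambda>j. (if j = k then 1 else 0) + (if j = l then 1 else 0 :: real))"
  shows "0 \<le> a j" "real (rpoly_den p) * a j \<in> \<int>" "(\<Sum>j\<in>UNIV. a j) \<le> 2"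
    "0 < Poly_Mapping.lookup p m \<Longrightarrow> 0 < Poly_Mapping.lookup m j \<Longrightarrow> 0 < a j"
    "0 < a j \<Longrightarrow> 1 - q j \<le> real (rpoly_den p) * (1 - rpoly_eval p q)"
    "(\<Sum>j\<in>UNIV. a j * (1 - q j)) = (1 - rpoly_eval p q) + (1 - q k) * (1 - q l)"
proof -
  show "0 \<le> a j" by (simp add: a_def)
  show "real (rpoly_den p) * a j \<in> \<int>" by (simp add: a_def)
  show "(\<Sum>j\<in>UNIV. a j) \<le> 2" by (simp add: a_def sum.distrib)
  show "0 < a j" if "0 < Poly_Mapping.lookup p m" "0 < Poly_Mapping.lookup m j"
    using lookup_product_pos[of k l m j] that unfolding p a_def by auto
  have eval: "rpoly_eval p q = q k * q l" unfolding p by (rule rpoly_eval_product)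
  show "(\<Sum>j\<in>UNIV. a j * (1 - q j)) = (1 - rpoly_eval p q) + (1 - q k) * (1 - q l)"
  proof -
    have "(\<Sum>j\<in>UNIV. a j * (1 - q j)) = (1 - q k) + (1 - q l)" unfolding a_def
      by (simp add: distrib_right sum.distrib if_distrib[of "\<lambda>x. x * _"] cong: if_cong)
    then show ?thesis by (simp add: eval algebra_simps)
  qed
  show "1 - q j \<le> real (rpoly_den p) * (1 - rpoly_eval p q)" if "0 < a j"
  proof -
    have "j = k \<or> j = l" using that by (auto simp: a_def split: if_splits)
    moreover have "q k * q l \<le> q k" "q k * q l \<le> q l"
      using q[of k] q[of l] by (auto simp: mult_le_cancel_left1 mult_le_cancel_right1)
    ultimately have "1 - q j \<le> 1 * (1 - rpoly_eval p q)" unfolding eval by auto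
    also have "\<dots> \<le> real (rpoly_den p) * (1 - rpoly_eval p q)"
      using rpoly_den_ge_1[of p] \<open>q k * q l \<le> q k\<close> q[of k] unfolding eval
      by (intro mult_right_mono) (simp, linarith)
    finally show ?thesis .
  qed
qed


text \<open>If all rows were affine, every point on the line through \<open>1\<close> and
  \<open>q\<close> would be a solution; a small step from \<open>q\<close> away from
  \<open>1\<close> would give a smaller nonnegative one.\<close>

lemma LFP_imp_product_row:
  fixes P :: "'n::finite \<Rightarrow> 'n rpoly"
  assumes snf: "simple_normal_form P" and one: "\<And>i. rpoly_eval (P i) (\<lambda>_. 1) = 1"
    and LFP: "is_LFP P q" and q: "\<And>i. 0 < q i" "\<And>i. q i < 1"
  shows "\<exists>i j k. P i = rpoly_var j * rpoly_var k"
proof (rule ccontr)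
  assume "\<not> ?thesis"
  then have aff: "\<exists>c c0. P i = rpoly_affine c c0" for i
    using snf unfolding simple_normal_form_def by blast
  \<comment> \<open>This step length keeps \<open>x\<close> nonnegative, since
    \<open>s * (1 - q i) \<le> s \<le> q i\<close>.\<close>
  define s where "s = Min (range q)"
  have s: "0 < s" "s \<le> q i" for i using q(1) by (auto simp: s_def)
  define x where "x i = q i - s * (1 - q i)" for i
  have "x i = rpoly_eval (P i) x" for i
  proof -
    obtain c c0 where P: "P i = rpoly_affine c c0" using aff by blast
    have "rpoly_eval (P i) q = q i" using LFP by (simp add: is_LFP_def is_solution_def)
    moreover have "rpoly_eval (P i) x
        = rpoly_eval (P i) q - s * (rpoly_eval (P i) (\<lambda>_. 1) - rpoly_eval (P i) q)"
      unfolding P rpoly_eval_affine x_def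
      by (simp add: algebra_simps sum.distrib sum_subtractf sum_distrib_left)
    ultimately show ?thesis using one by (simp add: x_def)
  qed
  moreover have "0 \<le> x i" for i
  proof -
    have "s * (1 - q i) \<le> s * 1" using s(1) q(1)[of i] by (intro mult_left_mono) auto
    then show ?thesis using s(2)[of i] by (simp add: x_def)
  qed
  ultimately have "q i \<le> x i" for i
    using LFP unfolding is_LFP_def is_solution_def by blast
  moreover have "x i < q i" for i using s(1) q(2)[of i] by (simp add: x_def)
  ultimately show False by (meson not_le)
qed

section \<open>From the rows to the bound on the LFP\<close>

theorem theoremA3:
  fixes P :: "'n::finite \<Rightarrow> 'n rpoly" and q :: "'n \<Rightarrow> real"
  assumes "PPS P"
    and "simple_normal_form P"
    and "strongly_connected P"
    and "\<forall>i. rpoly_eval (P i) (\<lambda>_. 1) = 1"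
    and "is_LFP P q"
    and "\<forall>i. 0 < q i \<and> q i < 1"
  shows "\<exists>i. q i < 1 - 2 powr (- 3 * real (pps_size P))"
proof -
  have nonneg: "0 \<le> Poly_Mapping.lookup (P i) m" for i m using assms(1) by (simp add: PPS_def)
  have one: "rpoly_eval (P i) (\<lambda>_. 1) = 1" for i using assms(4) by simp
  have q: "0 < q i" "q i < 1" for i using assms(6) by auto
  have qP: "rpoly_eval (P i) q = q i" for i
    using assms(5) by (simp add: is_LFP_def is_solution_def)
  let ?v = "\<lambda>i. 1 - q i"
  obtain m where vm: "?v i \<le> ?v m" for i
  proof -
    obtain m where "q m = Min (range q)" 
      using Min_in[of "range q"] by (metis finite imageE finite_imageI UNIV_not_empty image_is_empty)
    then show thesis using that[of m] by simp
  qed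
  \<comment> \<open>Gathers what the matrix bound needs from a single row, so that the two normal
    forms are handled separately before the rows are assembled into \<open>A\<close>.\<close>
  define row where "row i a \<longleftrightarrow> (\<forall>j. 0 \<le> a j) \<and> (\<forall>j. real (rpoly_den (P i)) * a j \<in> \<int>) \<and>
      (\<Sum>j\<in>UNIV. a j) \<le> 2 \<and>
      (\<forall>m j. 0 < Poly_Mapping.lookup (P i) m \<and> 0 < Poly_Mapping.lookup m j \<longrightarrow> 0 < a j) \<and>
      (\<forall>j. 0 < a j \<longrightarrow> ?v j \<le> real (rpoly_den (P i)) * ?v i) \<and>
      ?v i \<le> (\<Sum>j\<in>UNIV. a j * ?v j) \<and> (\<Sum>j\<in>UNIV. a j * ?v j) - ?v i \<le> (?v m)\<^sup>2 \<and>
      ((\<exists>j k. P i = rpoly_var j * rpoly_var k) \<longrightarrow> ?v i < (\<Sum>j\<in>UNIV. a j * ?v j))" for i a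
  have "\<exists>a. row i a" for i
  proof (cases "\<exists>j k. P i = rpoly_var j * rpoly_var k")
    case True
    then obtain k l where P: "P i = rpoly_var k * rpoly_var l" by blast
    define a where "a = (\<lambda>j. (if j = k then 1 else 0) + (if j = l then 1 else 0 :: real))"
    have "0 < ?v k * ?v l" using q by simp
    moreover have "?v k * ?v l \<le> (?v m)\<^sup>2"
      unfolding power2_eq_square using q less_imp_le by (intro mult_mono vm) (auto simp: less_imp_le)
    ultimately have "row i a"
      using linearized_product_row[where q = q, OF P q a_def] unfolding row_def qP by simp blast
    then show ?thesis by blast
  next
    case False
    then obtain c c0 where P: "P i = rpoly_affine c c0"
      using assms(2) unfolding simple_normal_form_def by blast
    define a where "a = (\<lambda>j. real_of_rat (c j))"
    have "row i a"
      using linearized_affine_row[where q = q, OF P nonneg one q(2)] False unfolding row_def qP a_def by simp blast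
    then show ?thesis by blast
  qed
  then obtain A where A: "\<And>i. row i (A i)" by metis
  obtain i0 j k where "P i0 = rpoly_var j * rpoly_var k"
    using LFP_imp_product_row[OF assms(2) one assms(5) q] by blast
  then have strict: "?v i0 < (\<Sum>j\<in>UNIV. A i0 j * ?v j)" using A[of i0] by (auto simp: row_def)
  have "dependency_graph P \<subseteq> {(i, j). 0 < A i j}"
    using A by (auto simp: dependency_graph_def row_def)
  then have irr: "(i, j) \<in> {(i, j). 0 < A i j}\<^sup>*" for i j
    using assms(3) rtrancl_mono unfolding strongly_connected_def by blast
  let ?D = "\<Prod>i\<in>UNIV. 4 * real (rpoly_den (P i))"
  have bound: "1 < ?D ^ 3 * ?v m"
  proof (rule subinvariant_vector_max_bound[OF _ irr _ vm _ _ strict rpoly_den_ge_1])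
  qed (use A q in \<open>auto simp: row_def\<close>)
  \<comment> \<open>Of the two factors \<open>2\<close> in each \<open>4\<close>, one is paid by a
    numerator bit and the other by the summand \<open>CARD('n)\<close> of \<open>pps_size\<close>,
    which supplies \<open>1\<close> per row.\<close>
  have "?D \<le> (\<Prod>i\<in>UNIV. 2 ^ (1 + rpoly_bits (P i)))"
  proof (rule prod_mono, safe)
    fix i
    have "Poly_Mapping.keys (P i) \<noteq> {}" using one[of i] by (auto simp: rpoly_eval_def)
    then have "2 * (2 * rpoly_den (P i)) \<le> 2 * 2 ^ rpoly_bits (P i)"
      by (intro mult_left_mono two_rpoly_den_le nonneg) auto
    then have "real (2 * (2 * rpoly_den (P i))) \<le> real (2 * 2 ^ rpoly_bits (P i))"
      by (simp only: of_nat_le_iff)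
    then show "4 * real (rpoly_den (P i)) \<le> 2 ^ (1 + rpoly_bits (P i))" by simp
  qed simp
  also have "\<dots> = 2 ^ pps_size P"
    unfolding power_sum[symmetric] pps_size_def by (simp only: sum.distrib sum_constant) simp
  finally have "?D ^ 3 \<le> (2 ^ pps_size P) ^ 3" by (intro power_mono prod_nonneg) auto
  then have "?D ^ 3 * ?v m \<le> (2 ^ pps_size P) ^ 3 * ?v m"
    using q[of m] by (intro mult_right_mono) auto
  with bound have "1 < (2 ^ pps_size P) ^ 3 * ?v m" by linarith
  moreover have "2 powr (- 3 * real (pps_size P)) = 1 / (2 ^ pps_size P) ^ 3"
  proof -
    have "2 powr (- 3 * real (pps_size P)) = 1 / 2 powr real (pps_size P * 3)"
      using powr_minus_divide[of 2 "3 * real (pps_size P)"] by (simp add: mult.commute)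
    also have "\<dots> = 1 / 2 ^ (pps_size P * 3)" by (simp only: powr_realpow zero_less_numeral)
    finally show ?thesis by (simp only: power_mult)
  qed
  ultimately have "2 powr (- 3 * real (pps_size P)) < ?v m"
    by (simp add: divide_less_eq mult.commute)
  then show ?thesis by (intro exI[of _ m]) simp
qed

end
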